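(* Let $\mathcal{X}$ be an input space which is either a discrete integer lattice or a subset of $\mathbb{R}^d$, and let $P_X$ be a probability distribution on $\mathcal{X}$. Let $f:\mathcal{X}\to[0,1]$ be a deterministic measurable target function, and let $f^{\mathrm{low}}$ be a deterministic measurable $[0,1]$-valued function on $\mathcal{X}$ (an approximation of $f$). Fix $\Delta>0$, and assume that $f^{\mathrm{low}}(x-\Delta)$ and $f^{\mathrm{low}}(x+\Delta)$ are defined (and measurable in $x$) for all $x\in\mathcal{X}$. Consider the feature maps $$\phi_1(x)=f^{\mathrm{low}}(x),\qquad \phi_2(x)=\big(\phi_1(x-\Delta),\,\phi_1(x),\,\phi_1(x+\Delta)\big),\qquad \phi_3(x)=\big(\phi_2(x),\,x,\,x-\Delta,\,x+\Delta\big).$$ Then the optimal expected errors satisfy $$\mathcal{R}^*(\phi_1,f)\ \ge\ \mathcal{R}^*(\phi_2,f)\ \ge\ \mathcal{R}^*(\phi_3,f)=0 .$$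
   Context: A feature map is a deterministic measurable function $\phi:\mathcal{X}\to\mathcal{Z}$ into a feature space $\mathcal{Z}$ (a measurable space). Its hypothesis class $\mathcal{H}(\phi)$ is the set of all deterministic measurable functions $h:\mathcal{Z}\to[0,1]$. The optimal expected error of $\phi$ for the target $f$ is $$\mathcal{R}^*(\phi,f)=\min_{h\in\mathcal{H}(\phi)}\ \mathbb{E}_{x\sim P_X}\big[(f(x)-h(\phi(x)))^2\big].$$ Subsets of $\mathbb{R}^d$ carry the Borel $\sigma$-algebra, discrete sets the discrete $\sigma$-algebra, and products the product $\sigma$-algebra. The points $x\pm\Delta$ are the translates of $x$ by the fixed shift $\Delta$ (added to each coordinate). The function $f^{\mathrm{low}}$ is arbitrary: no quantitative closeness to $f$ is assumed. *)

theory Defs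
  imports "HOL-Probability.Probability"
begin

definition unit_space :: "real measure" where
  "unit_space = restrict_space borel {0..1}"

definition integer_lattice :: "(real ^ 'n) set" where
  "integer_lattice = {x. \<forall>i. x $ i \<in> \<int>}"

text \<open>A feature map into the measurable space \<open>Z\<close> is a \<open>\<phi> \<in> P \<rightarrow>\<^sub>M Z\<close>; its hypothesis class depends
  on \<open>\<phi>\<close> only through \<open>Z\<close>. Hypotheses are total HOL functions, but only their
  values on \<open>space Z\<close> are constrained and matter.\<close>

definition hypothesis_class :: "'z measure \<Rightarrow> ('z \<Rightarrow> real) set" where
  "hypothesis_class Z = Z \<rightarrow>\<^sub>M unit_space"

definition expected_error :: "'x measure \<Rightarrow> ('x \<Rightarrow> 'z) \<Rightarrow> ('x \<Rightarrow> real) \<Rightarrow> ('z \<Rightarrow> real) \<Rightarrow> real" where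
  "expected_error P \<phi> f h = (\<integral>x. (f x - h (\<phi> x))\<^sup>2 \<partial>P)"

text \<open>The minimum over the hypothesis class. It is attained whenever \<open>P\<close> is a probability measure and
  \<open>\<phi>\<close>, \<open>f\<close> are measurable, see \<open>optimal_error_minimal\<close> below.\<close>

definition optimal_error :: "'x measure \<Rightarrow> 'z measure \<Rightarrow> ('x \<Rightarrow> 'z) \<Rightarrow> ('x \<Rightarrow> real) \<Rightarrow> real" where
  "optimal_error P Z \<phi> f = (LEAST r. \<exists>h\<in>hypothesis_class Z. r = expected_error P \<phi> f h)"

definition phi1 :: "(real ^ 'n \<Rightarrow> real) \<Rightarrow> real ^ 'n \<Rightarrow> real" where
  "phi1 flow x = flow x"

definition phi2 :: "real \<Rightarrow> (real ^ 'n \<Rightarrow> real) \<Rightarrow> real ^ 'n \<Rightarrow> real \<times> real \<times> real" where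
  "phi2 \<Delta> flow x = (phi1 flow (x - vec \<Delta>), phi1 flow x, phi1 flow (x + vec \<Delta>))"

definition phi3 :: "real \<Rightarrow> (real ^ 'n \<Rightarrow> real) \<Rightarrow> real ^ 'n \<Rightarrow>
    (real \<times> real \<times> real) \<times> (real ^ 'n) \<times> (real ^ 'n) \<times> (real ^ 'n)" where
  "phi3 \<Delta> flow x = (phi2 \<Delta> flow x, x, x - vec \<Delta>, x + vec \<Delta>)"

definition space1 :: "real measure" where
  "space1 = unit_space"

definition space2 :: "(real \<times> real \<times> real) measure" where
  "space2 = unit_space \<Otimes>\<^sub>M unit_space \<Otimes>\<^sub>M unit_space"

text \<open>\<open>S\<close> assigns to each set of points its \<open>\<sigma>\<close>-algebra: \<open>count_space\<close> for the lattice,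
  \<open>restrict_space borel\<close> for general subsets of Euclidean space.\<close>

definition space3 :: "((real ^ 'n) set \<Rightarrow> (real ^ 'n) measure) \<Rightarrow> (real ^ 'n) set \<Rightarrow> real \<Rightarrow>
    ((real \<times> real \<times> real) \<times> (real ^ 'n) \<times> (real ^ 'n) \<times> (real ^ 'n)) measure" where
  "space3 S X \<Delta> = space2 \<Otimes>\<^sub>M S X \<Otimes>\<^sub>M S ((\<lambda>x. x - vec \<Delta>) ` X) \<Otimes>\<^sub>M S ((\<lambda>x. x + vec \<Delta>) ` X)"

lemma measurable_unit_space_iff:
  "g \<in> M \<rightarrow>\<^sub>M unit_space \<longleftrightarrow> g \<in> borel_measurable M \<and> (\<forall>x\<in>space M. 0 \<le> g x \<and> g x \<le> 1)"
  unfolding unit_space_def by (auto simp: measurable_restrict_space2_iff)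

text \<open>The regression function is a Radon-Nikodym density; its truncation to \<open>[0,1]\<close> attains the minimum.\<close>

lemma regression_function_exists:
  fixes P :: "'x measure" and Z :: "'z measure"
  assumes P: "prob_space P" and phi: "\<phi> \<in> P \<rightarrow>\<^sub>M Z" and f: "f \<in> P \<rightarrow>\<^sub>M unit_space"
  obtains D :: "'z \<Rightarrow> real" where
    "D \<in> borel_measurable Z" "\<And>z. 0 \<le> D z" "integrable (distr P Z \<phi>) D"
    "\<And>h. h \<in> hypothesis_class Z \<Longrightarrow>
       (\<integral>x. h (\<phi> x) * f x \<partial>P) = (\<integral>z. h z * D z \<partial>distr P Z \<phi>)"
proof -
  interpret P: prob_space P by fact
  have [measurable]: "\<phi> \<in> P \<rightarrow>\<^sub>M Z" by fact
  have fm[measurable]: "f \<in> borel_measurable P" and f01: "\<And>x. x \<in> space P \<Longrightarrow> 0 \<le> f x \<and> f x \<le> 1"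
    using f by (auto simp: measurable_unit_space_iff)
  define N where "N = distr P Z \<phi>"
  define Q where "Q = distr (density P (\<lambda>x. ennreal (f x))) Z \<phi>"
  interpret N: prob_space N unfolding N_def by (rule P.prob_space_distr) fact
  have setsN[measurable_cong, simp]: "sets N = sets Z" by (simp add: N_def)
  have setsQ[measurable_cong, simp]: "sets Q = sets Z" by (simp add: Q_def)
  have spQ: "space Q = space Z" "space N = space Z" by (auto simp: N_def Q_def)
  have intf: "integrable P f"
    by (rule P.integrable_const_bound[where B=1]) (auto intro!: AE_I2 dest: f01)
  have finQ: "finite_measure Q"
  proof
    have "emeasure Q (space Q) = (\<integral>\<^sup>+x. ennreal (f x) * indicator (\<phi> -` space Z \<inter> space P) x \<partial>P)"
      unfolding Q_def by (simp add: emeasure_distr emeasure_density)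
    also have "\<dots> \<le> (\<integral>\<^sup>+x. 1 \<partial>P)"
      by (rule nn_integral_mono) (auto split: split_indicator dest: f01)
    also have "\<dots> = 1" by (simp add: P.emeasure_space_1)
    finally show "emeasure Q (space Q) \<noteq> \<infinity>" by (auto simp: top_unique)
  qed
  interpret Q: finite_measure Q by fact
  have ac: "absolutely_continuous N Q"
    unfolding absolutely_continuous_def
  proof
    fix A assume A: "A \<in> null_sets N"
    then have [measurable]: "A \<in> sets Z" by auto
    have "emeasure P (\<phi> -` A \<inter> space P) = 0"
      using A by (auto simp: N_def null_sets_def emeasure_distr)
    then have "\<phi> -` A \<inter> space P \<in> null_sets P" by auto
    then have "AE x in P. x \<notin> \<phi> -` A \<inter> space P" by (rule AE_not_in)
    then have "(\<integral>\<^sup>+x. ennreal (f x) * indicator (\<phi> -` A \<inter> space P) x \<partial>P) = (\<integral>\<^sup>+x. 0 \<partial>P)"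
      by (intro nn_integral_cong_AE) (auto elim!: eventually_mono)
    then show "A \<in> null_sets Q"
      by (auto simp: Q_def null_sets_def emeasure_distr emeasure_density)
  qed
  obtain D where D[measurable]: "D \<in> borel_measurable N"
    and AED: "AE x in N. RN_deriv N Q x = ennreal (D x)" and D0: "\<And>x. 0 \<le> D x"
    using N.real_RN_deriv[OF finQ ac] by (metis setsQ setsN)
  have dens: "density N (\<lambda>x. ennreal (D x)) = Q"
  proof -
    have "density N (\<lambda>x. ennreal (D x)) = density N (RN_deriv N Q)"
      using AED by (intro density_cong) auto
    also have "\<dots> = Q" using ac by (intro N.density_RN_deriv) auto
    finally show ?thesis .
  qed
  have "integrable Q (\<lambda>_. 1::real)" by simp
  then have intD: "integrable N D"
    unfolding dens[symmetric] by (subst (asm) integrable_density) (auto simp: D0)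
  have "(\<integral>x. h (\<phi> x) * f x \<partial>P) = (\<integral>z. h z * D z \<partial>N)" if h: "h \<in> hypothesis_class Z" for h
  proof -
    have [measurable]: "h \<in> borel_measurable Z"
      using h by (auto simp: hypothesis_class_def measurable_unit_space_iff)
    have "(\<integral>x. h (\<phi> x) * f x \<partial>P) = (\<integral>x. h (\<phi> x) \<partial>density P (\<lambda>x. ennreal (f x)))"
      by (subst integral_density) (auto simp: mult.commute intro!: AE_I2 dest: f01)
    also have "\<dots> = (\<integral>z. h z \<partial>Q)"
      unfolding Q_def by (subst integral_distr) auto
    also have "\<dots> = (\<integral>z. h z * D z \<partial>N)"
      unfolding dens[symmetric] by (subst integral_density) (auto simp: mult.commute D0)
    finally show ?thesis .
  qed
  with that[of D] D D0 intD show thesis by (simp add: N_def)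
qed

lemma optimal_error_minimal:
  fixes P :: "'x measure" and Z :: "'z measure"
  assumes P: "prob_space P" and phi: "\<phi> \<in> P \<rightarrow>\<^sub>M Z" and f: "f \<in> P \<rightarrow>\<^sub>M unit_space"
  shows "\<exists>h\<in>hypothesis_class Z. optimal_error P Z \<phi> f = expected_error P \<phi> f h"
    and "h \<in> hypothesis_class Z \<Longrightarrow> optimal_error P Z \<phi> f \<le> expected_error P \<phi> f h"
proof -
  interpret P: prob_space P by fact
  have [measurable]: "\<phi> \<in> P \<rightarrow>\<^sub>M Z" by fact
  have fm[measurable]: "f \<in> borel_measurable P" and f01: "\<And>x. x \<in> space P \<Longrightarrow> 0 \<le> f x \<and> f x \<le> 1"
    using f by (auto simp: measurable_unit_space_iff)
  obtain D :: "'z \<Rightarrow> real" where D[measurable]: "D \<in> borel_measurable Z" and D0: "\<And>z. 0 \<le> D z"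
    and intD: "integrable (distr P Z \<phi>) D"
    and eq: "\<And>h. h \<in> hypothesis_class Z \<Longrightarrow>
       (\<integral>x. h (\<phi> x) * f x \<partial>P) = (\<integral>z. h z * D z \<partial>distr P Z \<phi>)"
    using regression_function_exists[OF assms] by blast
  define N where "N = distr P Z \<phi>"
  interpret N: prob_space N unfolding N_def by (rule P.prob_space_distr) fact
  have setsN[measurable_cong, simp]: "sets N = sets Z" by (simp add: N_def)
  have spN: "space N = space Z" by (auto simp: N_def)
  have intf2: "integrable P (\<lambda>x. (f x)\<^sup>2)"
    by (rule P.integrable_const_bound[where B=1])
       (auto intro!: AE_I2 power_le_one dest: f01)
  have hN: "integrable N (\<lambda>z. (h z)\<^sup>2)" "integrable N (\<lambda>z. h z * D z)"
    and err: "expected_error P \<phi> f h = (\<integral>x. (f x)\<^sup>2 \<partial>P) + (\<integral>z. (h z)\<^sup>2 - 2 * (h z * D z) \<partial>N)"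
    if h: "h \<in> hypothesis_class Z" for h
  proof -
    have hm[measurable]: "h \<in> borel_measurable Z" and h01: "\<And>z. z \<in> space Z \<Longrightarrow> 0 \<le> h z \<and> h z \<le> 1"
      using h by (auto simp: hypothesis_class_def measurable_unit_space_iff)
    have h01': "x \<in> space P \<Longrightarrow> 0 \<le> h (\<phi> x) \<and> h (\<phi> x) \<le> 1" for x
      using measurable_space[OF phi] h01 by blast
    show i1: "integrable N (\<lambda>z. (h z)\<^sup>2)"
      by (rule N.integrable_const_bound[where B=1])
         (auto intro!: AE_I2 power_le_one simp: spN dest: h01)
    show i2: "integrable N (\<lambda>z. h z * D z)"
      using intD unfolding N_def[symmetric]
      by (rule Bochner_Integration.integrable_bound)
         (auto intro!: AE_I2 mult_left_le_one_le simp: spN abs_mult D0 h01)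
    have i3: "integrable P (\<lambda>x. (h (\<phi> x))\<^sup>2)"
      by (rule P.integrable_const_bound[where B=1])
         (auto intro!: AE_I2 power_le_one dest: h01')
    have i4: "integrable P (\<lambda>x. h (\<phi> x) * f x)"
      by (rule P.integrable_const_bound[where B=1])
         (auto intro!: AE_I2 mult_le_one simp: abs_mult dest: f01 h01')
    have "expected_error P \<phi> f h = (\<integral>x. (f x)\<^sup>2 + ((h (\<phi> x))\<^sup>2 - 2 * (h (\<phi> x) * f x)) \<partial>P)"
      unfolding expected_error_def by (simp add: power2_diff algebra_simps)
    also have "\<dots> = (\<integral>x. (f x)\<^sup>2 \<partial>P) + ((\<integral>x. (h (\<phi> x))\<^sup>2 \<partial>P) - 2 * (\<integral>x. h (\<phi> x) * f x \<partial>P))"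
      using intf2 i3 i4 by simp
    also have "(\<integral>x. (h (\<phi> x))\<^sup>2 \<partial>P) = (\<integral>z. (h z)\<^sup>2 \<partial>N)"
      unfolding N_def by (subst integral_distr) auto
    also have "(\<integral>x. h (\<phi> x) * f x \<partial>P) = (\<integral>z. h z * D z \<partial>N)"
      using eq[OF h] by (simp add: N_def)
    finally show "expected_error P \<phi> f h =
        (\<integral>x. (f x)\<^sup>2 \<partial>P) + (\<integral>z. (h z)\<^sup>2 - 2 * (h z * D z) \<partial>N)"
      using i1 i2 by simp
  qed
  define h0 where "h0 z = min 1 (D z)" for z
  have "h0 \<in> borel_measurable Z"
    unfolding h0_def[abs_def] by measurable
  then have h0: "h0 \<in> hypothesis_class Z"
    by (auto simp: hypothesis_class_def measurable_unit_space_iff h0_def D0)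
  have le: "expected_error P \<phi> f h0 \<le> expected_error P \<phi> f h" if h: "h \<in> hypothesis_class Z" for h
  proof -
    have "(h0 z)\<^sup>2 - 2 * (h0 z * D z) \<le> (h z)\<^sup>2 - 2 * (h z * D z)" if z: "z \<in> space N" for z
    proof -
      have h1: "h z \<le> 1"
        using h z by (auto simp: hypothesis_class_def measurable_unit_space_iff spN)
      have "0 \<le> (h z - h0 z) * (h z + h0 z - 2 * D z)"
      proof (cases "D z \<le> 1")
        case True
        then show ?thesis by (simp add: h0_def flip: power2_eq_square)
      next
        case False
        then show ?thesis using h1 by (simp add: h0_def mult_nonpos_nonpos)
      qed
      then show ?thesis by (simp add: power2_eq_square algebra_simps)
    qed
    then show ?thesis
      unfolding err[OF h0] err[OF h] using hN[OF h0] hN[OF h]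
      by (intro add_left_mono integral_mono) auto
  qed
  have opt: "optimal_error P Z \<phi> f = expected_error P \<phi> f h0"
    unfolding optimal_error_def using h0 le by (intro Least_equality) auto
  show "\<exists>h\<in>hypothesis_class Z. optimal_error P Z \<phi> f = expected_error P \<phi> f h"
    using opt h0 by auto
  show "h \<in> hypothesis_class Z \<Longrightarrow> optimal_error P Z \<phi> f \<le> expected_error P \<phi> f h"
    using opt le by auto
qed

end

theory Submission
  imports Defs
begin

text \<open>A feature map that determines another one measurably is at least as informative: if
  \<open>\<phi> = g \<circ> \<psi>\<close> on the input space, every hypothesis \<open>h\<close> on
  \<open>\<phi>\<close> is matched by \<open>h \<circ> g\<close> on \<open>\<psi>\<close> with the
  same error (\<open>optimal_error_antimono\<close>). Both inequalities follow, since each feature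
  map is a coordinate projection of the next. The last map carries \<open>x\<close> itself, so
  \<open>f\<close> is a hypothesis on it with zero error (\<open>optimal_error_eq_0\<close>). What
  remains is measurability.\<close>

lemma optimal_error_antimono:
  assumes P: "prob_space P" and phi: "\<phi> \<in> P \<rightarrow>\<^sub>M Z" and psi: "\<psi> \<in> P \<rightarrow>\<^sub>M W"
    and f: "f \<in> P \<rightarrow>\<^sub>M unit_space" and g: "g \<in> W \<rightarrow>\<^sub>M Z"
    and factor: "\<And>x. x \<in> space P \<Longrightarrow> \<phi> x = g (\<psi> x)"
  shows "optimal_error P W \<psi> f \<le> optimal_error P Z \<phi> f"
proof -
  \<comment> \<open>Attainment of the minimum allows an optimal \<open>h\<close> to be pulled back
    directly, without an approximation argument.\<close>
  obtain h where h: "h \<in> hypothesis_class Z" and opt: "optimal_error P Z \<phi> f = expected_error P \<phi> f h"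
    using optimal_error_minimal(1)[OF P phi f] by blast
  have "h \<circ> g \<in> hypothesis_class W"
    using g h unfolding hypothesis_class_def by (rule measurable_comp)
  then have "optimal_error P W \<psi> f \<le> expected_error P \<psi> f (h \<circ> g)"
    by (rule optimal_error_minimal(2)[OF P psi f])
  also have "\<dots> = expected_error P \<phi> f h"
    unfolding expected_error_def by (intro Bochner_Integration.integral_cong) (simp_all add: factor)
  finally show ?thesis
    using opt by simp
qed

lemma optimal_error_eq_0:
  assumes P: "prob_space P" and phi: "\<phi> \<in> P \<rightarrow>\<^sub>M Z" and f: "f \<in> P \<rightarrow>\<^sub>M unit_space"
    and h: "h \<in> hypothesis_class Z" and factor: "\<And>x. x \<in> space P \<Longrightarrow> f x = h (\<phi> x)"
  shows "optimal_error P Z \<phi> f = 0"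
proof (rule antisym)
  have "expected_error P \<phi> f h = (\<integral>x. 0 \<partial>P)"
    unfolding expected_error_def by (intro Bochner_Integration.integral_cong) (simp_all add: factor)
  then show "optimal_error P Z \<phi> f \<le> 0"
    using optimal_error_minimal(2)[OF P phi f h] by simp
  \<comment> \<open>Being attained, the optimal value is the integral of a square, hence
    nonnegative.\<close>
  obtain h' where "optimal_error P Z \<phi> f = expected_error P \<phi> f h'"
    using optimal_error_minimal(1)[OF P phi f] by blast
  then show "0 \<le> optimal_error P Z \<phi> f"
    by (simp add: expected_error_def)
qed

lemma measurable_restrict_space_image:
  assumes "g \<in> M \<rightarrow>\<^sub>M N"
  shows "g \<in> restrict_space M X \<rightarrow>\<^sub>M restrict_space N (g ` X)"
  using assms by (intro measurable_restrict_space3) auto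

theorem theorem1:
  fixes X :: "(real ^ 'n) set"
    and S :: "(real ^ 'n) set \<Rightarrow> (real ^ 'n) measure"
    and PX :: "(real ^ 'n) measure"
    and f flow :: "real ^ 'n \<Rightarrow> real"
    and \<Delta> :: real
  assumes input_space: "X \<subseteq> integer_lattice \<and> S = count_space \<or> S = restrict_space borel"
    and PX: "prob_space PX" "sets PX = sets (S X)"
    and f: "f \<in> S X \<rightarrow>\<^sub>M unit_space"
    and flow: "flow \<in> S X \<rightarrow>\<^sub>M unit_space"
    and Delta_pos: "\<Delta> > 0"
    and flow_minus: "(\<lambda>x. flow (x - vec \<Delta>)) \<in> S X \<rightarrow>\<^sub>M unit_space"
    and flow_plus: "(\<lambda>x. flow (x + vec \<Delta>)) \<in> S X \<rightarrow>\<^sub>M unit_space"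
  shows "optimal_error PX space1 (phi1 flow) f \<ge> optimal_error PX space2 (phi2 \<Delta> flow) f
    \<and> optimal_error PX space2 (phi2 \<Delta> flow) f \<ge> optimal_error PX (space3 S X \<Delta>) (phi3 \<Delta> flow) f
    \<and> optimal_error PX (space3 S X \<Delta>) (phi3 \<Delta> flow) f = 0"
proof -
  have shift: "t \<in> S X \<rightarrow>\<^sub>M S (t ` X)" if "t \<in> borel_measurable borel" for t
    using input_space that by (auto intro: measurable_restrict_space_image)
  have [measurable_cong]: "sets PX = sets (S X)"
    by fact
  have [measurable]: "(\<lambda>x. x - vec \<Delta>) \<in> S X \<rightarrow>\<^sub>M S ((\<lambda>x. x - vec \<Delta>) ` X)"
    "(\<lambda>x. x + vec \<Delta>) \<in> S X \<rightarrow>\<^sub>M S ((\<lambda>x. x + vec \<Delta>) ` X)"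
    by (rule shift; measurable)+
  note [measurable] = f flow flow_minus flow_plus
  have f': "f \<in> PX \<rightarrow>\<^sub>M unit_space"
    by measurable
  have phi1: "phi1 flow \<in> PX \<rightarrow>\<^sub>M space1"
    unfolding phi1_def[abs_def] space1_def by measurable
  \<comment> \<open>\<open>flow\<close> is known to be measurable only on \<open>X\<close>, so the
    outer coordinates rest on \<open>flow_minus\<close> and \<open>flow_plus\<close>.\<close>
  have phi2[measurable]: "phi2 \<Delta> flow \<in> PX \<rightarrow>\<^sub>M space2"
    unfolding phi2_def[abs_def] phi1_def space2_def by measurable
  have phi3: "phi3 \<Delta> flow \<in> PX \<rightarrow>\<^sub>M space3 S X \<Delta>"
    unfolding phi3_def[abs_def] space3_def by measurable
  have "optimal_error PX space2 (phi2 \<Delta> flow) f \<le> optimal_error PX space1 (phi1 flow) f"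
  proof (rule optimal_error_antimono[OF PX(1) phi1 phi2 f'])
    \<comment> \<open>The middle coordinate of \<open>phi2\<close> is \<open>phi1\<close>.\<close>
    show "(\<lambda>z. fst (snd z)) \<in> space2 \<rightarrow>\<^sub>M space1"
      unfolding space1_def space2_def by measurable
  qed (simp add: phi2_def)
  moreover have "optimal_error PX (space3 S X \<Delta>) (phi3 \<Delta> flow) f \<le> optimal_error PX space2 (phi2 \<Delta> flow) f"
  proof (rule optimal_error_antimono[OF PX(1) phi2 phi3 f'])
    show "fst \<in> space3 S X \<Delta> \<rightarrow>\<^sub>M space2"
      unfolding space3_def by measurable
  qed (simp add: phi3_def)
  moreover have "optimal_error PX (space3 S X \<Delta>) (phi3 \<Delta> flow) f = 0"
  proof (rule optimal_error_eq_0[OF PX(1) phi3 f'])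
    \<comment> \<open>The hypothesis reads off the copy of \<open>x\<close>; that factor of
      \<open>space3\<close> is \<open>S X\<close>, exactly where \<open>f\<close> is measurable with
      values in \<open>[0,1]\<close>.\<close>
    show "(\<lambda>z. f (fst (snd z))) \<in> hypothesis_class (space3 S X \<Delta>)"
      unfolding hypothesis_class_def space3_def by measurable
  qed (simp add: phi3_def)
  ultimately show ?thesis
    by simp
qed

end
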